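(* The family of closed blowups of trees is vertex-$R_\Delta$-bounded. More precisely, for all integers $d \ge 1$, $s \ge 2$ and $k \ge 1$ there is an integer $D$, depending only on $d$, $s$ and $k$, such that for every tree $T$ with $\Delta(T) \le d$ there is a graph $H$ with $\Delta(H) \le D$ in which every $s$-coloring of $V(H)$ contains a monochromatic copy of the closed $k$-blowup $T[k]$.
   Context: All graphs are finite and simple; $\Delta(G)$ denotes the maximum degree of $G$. The closed $k$-blowup of a graph $G$, denoted $G[k]$, is obtained by replacing every vertex of $G$ with a clique of size $k$ (these cliques being pairwise disjoint) and every edge of $G$ with a complete bipartite graph $K_{k,k}$ between the two corresponding cliques. An $s$-coloring of $V(H)$ is an arbitrary map from $V(H)$ to a set of $s$ colors. A monochromatic copy of $G$ in a vertex-colored graph $H$ is a (not necessarily induced) subgraph of $H$ isomorphic to $G$ all of whose vertices have the same color. Write $H \xrightarrow{s}_{\mathrm{vtx}} G$ if every $s$-coloring of $V(H)$ contains a monochromatic copy of $G$, and let $R^v_\Delta(G;s)=\min\{\Delta(H): H \xrightarrow{s}_{\mathrm{vtx}} G\}$. A family $\mathcal{G}$ of graphs is vertex-$R_\Delta$-bounded if for every positive integer $s$ and every $G \in \mathcal{G}$, the number $R^v_\Delta(G;s)$ is bounded by a function depending only on $\Delta(G)$ and $s$. *)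

theory Defs
  imports "Graph_Theory.Graph_Theory" "HOL-Library.Extended_Nat"
begin

text \<open>
  A finite simple graph is a symmetric loop-free finite digraph without parallel arcs
  (\<^locale>\<open>pair_graph\<close>): each undirected edge is represented by its two opposite arcs, so the
  degree of a vertex is its out-degree.
\<close>

text \<open>The value for the graph without vertices is 0.\<close>

definition max_degree :: "'a pair_pre_digraph \<Rightarrow> nat" where
  "max_degree G = Max (insert 0 (out_degree (with_proj G) ` pverts G))"

text \<open>
  The library predicate \<^const>\<open>tree\<close> is not usable for symmetric digraphs: its notion of cycle
  includes traversing one edge back and forth, so that no graph with an edge would be a tree.
  A cycle of an undirected simple graph has length at least 3.
  The predicate \<^const>\<open>connected\<close> includes having at least one vertex.
\<close>

definition undirected_tree :: "'a pair_pre_digraph \<Rightarrow> bool" where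
  "undirected_tree T \<longleftrightarrow>
     pair_graph T \<and> connected (with_proj T) \<and>
     \<not> (\<exists>p. pre_digraph.cycle (with_proj T) p \<and> 3 \<le> length p)"

definition closed_blowup :: "'a pair_pre_digraph \<Rightarrow> nat \<Rightarrow> ('a \<times> nat) pair_pre_digraph" where
  "closed_blowup G k =
     \<lparr> pverts = pverts G \<times> {..<k},
       parcs = {((u, i), (v, j)) | u i v j. u \<in> pverts G \<and> v \<in> pverts G \<and> i < k \<and> j < k \<and>
                  (u = v \<and> i \<noteq> j \<or> (u, v) \<in> parcs G)} \<rparr>"

definition monochromatic_copy ::
    "'a pair_pre_digraph \<Rightarrow> 'b pair_pre_digraph \<Rightarrow> ('b \<Rightarrow> 'c) \<Rightarrow> bool" where
  "monochromatic_copy G H \<chi> \<longleftrightarrow>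
     (\<exists>K :: 'b pair_pre_digraph. subgraph (with_proj K) (with_proj H) \<and>
        digraph_iso (with_proj G) (with_proj K) \<and>
        (\<forall>u \<in> pverts K. \<forall>v \<in> pverts K. \<chi> u = \<chi> v))"

definition vertex_arrows :: "'b pair_pre_digraph \<Rightarrow> nat \<Rightarrow> 'a pair_pre_digraph \<Rightarrow> bool" where
  "vertex_arrows H s G \<longleftrightarrow>
     (\<forall>\<chi> :: 'b \<Rightarrow> nat. \<chi> ` pverts H \<subseteq> {..<s} \<longrightarrow> monochromatic_copy G H \<chi>)"

text \<open>
  Up to isomorphism every finite graph has natural numbers as vertices. The infimum is taken in
  the extended naturals, so it is a minimum if some \<open>H\<close> exists, and \<open>\<infinity>\<close>
  (rather than an unintended 0) otherwise.
\<close>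

definition vertex_degree_ramsey :: "'a pair_pre_digraph \<Rightarrow> nat \<Rightarrow> enat" where
  "vertex_degree_ramsey G s =
     (INF H \<in> {H :: nat pair_pre_digraph. pair_graph H \<and> vertex_arrows H s G}.
        enat (max_degree H))"

definition vertex_degree_ramsey_bounded :: "'a pair_pre_digraph set \<Rightarrow> bool" where
  "vertex_degree_ramsey_bounded \<G> \<longleftrightarrow>
     (\<exists>f :: nat \<Rightarrow> nat \<Rightarrow> nat. \<forall>s \<ge> 1. \<forall>G \<in> \<G>.
        vertex_degree_ramsey G s \<le> enat (f (max_degree G) s))"

definition closed_tree_blowups :: "('a \<times> nat) pair_pre_digraph set" where
  "closed_tree_blowups = {closed_blowup T k | T k. undirected_tree T \<and> 1 \<le> k}"

end

theory Submission
  imports Defs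
begin

text \<open>
  Blowing up each vertex of a host into a clique of size \<open>s * k\<close> reduces the problem to \<open>k = 1\<close>:
  in every clique some colour occurs at least \<open>k\<close> times, so an \<open>s\<close>-colouring of the blowup induces an
  \<open>s\<close>-colouring of the host, and a monochromatic copy of \<open>T\<close> for the induced colouring extends to a
  monochromatic copy of the closed \<open>k\<close>-blowup. The maximum degree grows only by a factor that depends
  on \<open>s\<close> and \<open>k\<close>.

  For a tree \<open>T\<close> of maximum degree at most \<open>d\<close>, the host is a graph of bounded maximum degree that has no
  cycle of length at most \<open>|T|\<close> and whose independent sets are all smaller than a fraction \<open>1 / (s d)\<close>
  of the vertices (\<open>sparse_host\<close>). If no colour class contained a subgraph of minimum degree \<open>d\<close>, then
  each class would be degenerate and would contain an independent set of at least a \<open>1 / d\<close> fraction of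
  its size; one of the classes is large, which is a contradiction (\<open>dense_color_class\<close>). Inside a
  subgraph of minimum degree \<open>d\<close> the tree is embedded vertex by vertex. A new leaf always finds a
  neighbour not used by the tree neighbours of its parent, and if that neighbour were used elsewhere,
  it would close a cycle with at most \<open>|T|\<close> vertices (\<open>tree_embedding\<close>). Thus the size of \<open>T\<close> enters only
  through the girth, and the girth does not affect the degree bound.

  The host comes from the alteration method, phrased as counting. A random graph on \<open>N\<close> vertices is
  given by a function that selects \<open>m\<close> out-neighbours for each vertex. The average number of cycles of
  length \<open>l\<close> is at most \<open>(2 m) ^ l\<close>, which is independent of \<open>N\<close> (\<open>short_cycle_total_count\<close>), while a union
  bound shows that at least half of the functions leave no set of \<open>N / q\<close> vertices independent, as soon
  as \<open>m\<close> is of the order of \<open>q\<^sup>2\<close> (\<open>dense_funs_count\<close>). In a graph with both properties and \<open>N\<close> large,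
  it remains to delete a vertex of each short cycle and the few vertices of large in-degree.
\<close>

section \<open>Greedy embedding of trees under a girth condition\<close>

text \<open>
  A cycle of length at least 3 as the list of its vertices, in order. Listing vertices rather than arcs
  makes cycles easy to transport along vertex maps and easy to count.
\<close>

definition list_cycle :: "'a rel \<Rightarrow> 'a list \<Rightarrow> bool" where
  "list_cycle E xs \<longleftrightarrow> 3 \<le> length xs \<and> distinct xs \<and>
     successively (\<lambda>u v. (u, v) \<in> E) xs \<and> (last xs, hd xs) \<in> E"

definition linked :: "'a rel \<Rightarrow> 'a set \<Rightarrow> bool" where
  "linked E U \<longleftrightarrow> (\<forall>u\<in>U. \<forall>v\<in>U. \<exists>xs. xs \<noteq> [] \<and> distinct xs \<and> set xs \<subseteq> U \<and>
     successively (\<lambda>u v. (u, v) \<in> E) xs \<and> hd xs = u \<and> last xs = v)"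

lemma linked_insert:
  assumes "linked E U" "sym E" "u \<in> U" "(u, x) \<in> E" "x \<notin> U"
  shows "linked E (insert x U)"
  unfolding linked_def
proof (intro ballI)
  fix a b assume ab: "a \<in> insert x U" "b \<in> insert x U"
  have L: "\<exists>xs. xs \<noteq> [] \<and> distinct xs \<and> set xs \<subseteq> U \<and>
     successively (\<lambda>u v. (u, v) \<in> E) xs \<and> hd xs = a \<and> last xs = b"
     if "a \<in> U" "b \<in> U" for a b
    using assms(1) that unfolding linked_def by blast
  have xu: "(x, u) \<in> E" using assms by (meson symD)
  consider "a = x" "b = x" | "a = x" "b \<in> U" | "a \<in> U" "b = x" | "a \<in> U" "b \<in> U"
    using ab by blast
  then show "\<exists>xs. xs \<noteq> [] \<and> distinct xs \<and> set xs \<subseteq> insert x U \<and>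
     successively (\<lambda>u v. (u, v) \<in> E) xs \<and> hd xs = a \<and> last xs = b"
  proof cases
    case 1
    then show ?thesis by (intro exI[of _ "[x]"]) simp
  next
    case 2
    obtain xs where "xs \<noteq> []" "distinct xs" "set xs \<subseteq> U"
      "successively (\<lambda>u v. (u, v) \<in> E) xs" "hd xs = u" "last xs = b"
      using L[OF assms(3) 2(2)] by blast
    then show ?thesis using 2 xu assms(5)
      by (intro exI[of _ "x # xs"]) (auto simp: successively_Cons)
  next
    case 3
    obtain xs where "xs \<noteq> []" "distinct xs" "set xs \<subseteq> U"
      "successively (\<lambda>u v. (u, v) \<in> E) xs" "hd xs = a" "last xs = u"
      using L[OF 3(1) assms(3)] by blast
    then show ?thesis using 3 assms(4,5)
      by (intro exI[of _ "xs @ [x]"]) (auto simp: successively_append_iff)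
  next
    case 4
    then show ?thesis using L[OF 4] by blast
  qed
qed

text \<open>
  The embedding is built along a growing connected vertex set \<open>U\<close> of the tree. Acyclicity makes the new
  vertex \<open>x\<close> adjacent to a single vertex \<open>u\<close> of \<open>U\<close>, so only one adjacency has to be realised. At most
  \<open>d - 1\<close> tree neighbours of \<open>u\<close> are placed already, so the image of \<open>u\<close> has a neighbour in \<open>W\<close> that is none
  of their images. It is not the image of any other vertex of \<open>U\<close> either: the tree path to that vertex
  would be mapped to a path that this adjacency closes to a cycle of length at most \<open>card V\<close>.
\<close>

lemma tree_embedding:
  fixes E :: "'a rel" and A :: "'b rel"
  assumes finV: "finite V" and V0: "V \<noteq> {}" and EV: "E \<subseteq> V \<times> V" and symE: "sym E" and irrE: "irrefl E"
    and conn: "\<And>U. U \<subset> V \<Longrightarrow> U \<noteq> {} \<Longrightarrow> \<exists>u\<in>U. \<exists>x\<in>V - U. (u, x) \<in> E"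
    and acyc: "\<And>xs. \<not> list_cycle E xs"
    and degE: "\<And>v. v \<in> V \<Longrightarrow> card {w. (v, w) \<in> E} \<le> d"
    and symA: "sym A" and irrA: "irrefl A"
    and W: "finite W" "W \<noteq> {}" and degA: "\<And>w. w \<in> W \<Longrightarrow> d \<le> card {w'\<in>W. (w, w') \<in> A}"
    and girth: "\<And>xs. list_cycle A xs \<Longrightarrow> card V < length xs"
  shows "\<exists>\<phi>. inj_on \<phi> V \<and> \<phi> ` V \<subseteq> W \<and> (\<forall>u v. (u, v) \<in> E \<longrightarrow> (\<phi> u, \<phi> v) \<in> A)"
proof -
  have "\<exists>U\<subseteq>V. card U = Suc n \<and> linked E U \<and> (\<exists>\<phi>. inj_on \<phi> U \<and> \<phi> ` U \<subseteq> W \<and>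
     (\<forall>u\<in>U. \<forall>v\<in>U. (u, v) \<in> E \<longrightarrow> (\<phi> u, \<phi> v) \<in> A))" if "Suc n \<le> card V" for n
    using that
  proof (induction n)
    case 0
    obtain r w where "r \<in> V" "w \<in> W" using V0 W by blast
    moreover have "linked E {r}"
      unfolding linked_def by (auto intro!: exI[of _ "[r]"])
    ultimately show ?case using irrE
      by (intro exI[of _ "{r}"] conjI exI[of _ "\<lambda>_. w"]) (auto simp: irrefl_def)
  next
    case (Suc n)
    then obtain U \<phi> where U: "U \<subseteq> V" "card U = Suc n" "linked E U"
      and \<phi>: "inj_on \<phi> U" "\<phi> ` U \<subseteq> W" "\<And>u v. u \<in> U \<Longrightarrow> v \<in> U \<Longrightarrow> (u, v) \<in> E \<Longrightarrow> (\<phi> u, \<phi> v) \<in> A"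
      by auto
    have "U \<subset> V" "U \<noteq> {}" using U Suc.prems by auto
    then obtain u x where ux: "u \<in> U" "x \<in> V" "x \<notin> U" "(u, x) \<in> E" using conn by blast
    have xu: "(x, u) \<in> E" using ux symE by (meson symD)
    have finU: "finite U" using U finV finite_subset by blast
    have L: "\<exists>xs. xs \<noteq> [] \<and> distinct xs \<and> set xs \<subseteq> U \<and>
       successively (\<lambda>u v. (u, v) \<in> E) xs \<and> hd xs = u \<and> last xs = v"
       if "v \<in> U" for v
      using U(3) that ux(1) unfolding linked_def by blast
    (* A second neighbour of x in U would close a cycle in the tree. *)
    have uniq: "v = u" if v: "v \<in> U" "(v, x) \<in> E" for v
    proof (rule ccontr)
      assume ne: "v \<noteq> u"
      obtain xs where xs: "xs \<noteq> []" "distinct xs" "set xs \<subseteq> U"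
        "successively (\<lambda>u v. (u, v) \<in> E) xs" "hd xs = u" "last xs = v"
        using L[OF v(1)] by blast
      have "2 \<le> length xs" using xs ne by (cases xs; cases "tl xs") auto
      then have "list_cycle E (x # xs)"
        using xs v ux xu by (auto simp: list_cycle_def successively_Cons)
      then show False using acyc by blast
    qed
    have finN: "finite {w. (u, w) \<in> E}"
      by (rule finite_subset[OF _ finV]) (use EV in auto)
    have "{v\<in>U. (u, v) \<in> E} \<subset> {w. (u, w) \<in> E}" using ux by auto
    then have "card {v\<in>U. (u, v) \<in> E} < card {w. (u, w) \<in> E}"
      using finN by (rule psubset_card_mono[rotated])
    also have "\<dots> \<le> d" using degE ux U by blast
    also have "d \<le> card {w'\<in>W. (\<phi> u, w') \<in> A}" using degA \<phi> ux by blast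
    finally have "card (\<phi> ` {v\<in>U. (u, v) \<in> E}) < card {w'\<in>W. (\<phi> u, w') \<in> A}"
      by (rule le_less_trans[OF card_image_le, rotated]) (use finU in auto)
    then have "\<not> {w'\<in>W. (\<phi> u, w') \<in> A} \<subseteq> \<phi> ` {v\<in>U. (u, v) \<in> E}"
      using card_mono[of "\<phi> ` {v\<in>U. (u, v) \<in> E}" "{w'\<in>W. (\<phi> u, w') \<in> A}"] finU by auto
    then obtain w where w: "w \<in> W" "(\<phi> u, w) \<in> A" "w \<notin> \<phi> ` {v\<in>U. (u, v) \<in> E}" by blast
    have wu: "(w, \<phi> u) \<in> A" using w symA by (meson symD)
    (* Reusing an image would close a short cycle of the host. *)
    have wU: "w \<notin> \<phi> ` U"
    proof
      assume "w \<in> \<phi> ` U"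
      then obtain v where v: "v \<in> U" "w = \<phi> v" by blast
      have nE: "(u, v) \<notin> E" using v w by blast
      have ne: "u \<noteq> v" using v w irrA by (auto simp: irrefl_def)
      obtain xs where xs: "xs \<noteq> []" "distinct xs" "set xs \<subseteq> U"
        "successively (\<lambda>u v. (u, v) \<in> E) xs" "hd xs = u" "last xs = v"
        using L[OF v(1)] by blast
      (* A path on two vertices would make v a tree neighbour of u, which the choice of w excludes. *)
      have "3 \<le> length xs"
      proof (rule ccontr)
        assume "\<not> 3 \<le> length xs"
        moreover have "length xs \<noteq> 0" using xs(1) by simp
        ultimately have "length xs = 1 \<or> length xs = 2" by linarith
        then show False
          using xs ne nE by (auto simp: length_Suc_conv numeral_2_eq_2)
      qed
      moreover have "successively (\<lambda>u v. (u, v) \<in> A) (map \<phi> xs)"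
        unfolding successively_map
        by (rule successively_mono[OF xs(4)]) (use \<phi>(3) xs(3) in auto)
      ultimately have "list_cycle A (map \<phi> xs)"
        using xs v wu inj_on_subset[OF \<phi>(1) xs(3)]
        by (auto simp: list_cycle_def distinct_map last_map hd_map)
      then have "card V < length xs" using girth by fastforce
      also have "length xs = card (set xs)" using xs(2) by (simp add: distinct_card)
      also have "\<dots> \<le> card V" using xs(3) U(1) finV by (intro card_mono) auto
      finally show False by simp
    qed
    define \<psi> where "\<psi> = \<phi>(x := w)"
    have "inj_on \<psi> (insert x U)"
      using \<phi>(1) wU ux(3) unfolding \<psi>_def inj_on_def by auto
    moreover have "\<psi> ` insert x U \<subseteq> W" using \<phi>(2) w ux unfolding \<psi>_def by auto
    moreover have "(\<psi> a, \<psi> b) \<in> A" if ab: "a \<in> insert x U" "b \<in> insert x U" "(a, b) \<in> E" for a b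
    proof -
      have ba: "(b, a) \<in> E" using ab symE by (meson symD)
      have "a \<noteq> b" using ab irrE by (auto simp: irrefl_def)
      then consider "a = x" "b = u" | "b = x" "a = u" | "a \<in> U" "b \<in> U"
        using ab ba uniq by blast
      then show ?thesis
      proof cases
        case 1
        then show ?thesis using wu ux unfolding \<psi>_def by auto
      next
        case 2
        then show ?thesis using w ux unfolding \<psi>_def by auto
      next
        case 3
        then show ?thesis using \<phi>(3) ab ux unfolding \<psi>_def by auto
      qed
    qed
    moreover have "card (insert x U) = Suc (Suc n)" using U ux finU by simp
    ultimately show ?case
      using linked_insert[OF U(3) symE ux(1,4,3)] U(1) ux(2)
      by (intro exI[of _ "insert x U"] conjI exI[of _ \<psi>]) auto
  qed
  from this[of "card V - 1"] obtain U where "U \<subseteq> V" "card U = card V" and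
    U: "\<exists>\<phi>. inj_on \<phi> U \<and> \<phi> ` U \<subseteq> W \<and> (\<forall>u\<in>U. \<forall>v\<in>U. (u, v) \<in> E \<longrightarrow> (\<phi> u, \<phi> v) \<in> A)"
    using V0 finV card_gt_0_iff[of V] by (auto simp: Suc_diff_1)
  then have "U = V" using finV card_subset_eq by blast
  then obtain \<phi> where "inj_on \<phi> V" "\<phi> ` V \<subseteq> W"
    "\<And>u v. u \<in> V \<Longrightarrow> v \<in> V \<Longrightarrow> (u, v) \<in> E \<Longrightarrow> (\<phi> u, \<phi> v) \<in> A" using U by auto
  then show ?thesis using EV by (intro exI[of _ \<phi>]) auto
qed

text \<open>
  Greedy choice: take a vertex with fewer than \<open>d\<close> neighbours and discard it together with these
  neighbours. At most \<open>d\<close> vertices are spent on each chosen one.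
\<close>

lemma independent_subset_if_degenerate:
  assumes "finite S" "sym A"
    and "\<And>W. W \<subseteq> S \<Longrightarrow> W \<noteq> {} \<Longrightarrow> \<exists>w\<in>W. card {w'\<in>W. (w, w') \<in> A} < d"
  shows "\<exists>I\<subseteq>S. I \<times> I \<inter> A \<subseteq> Id \<and> card S \<le> d * card I"
  using assms(1,3)
proof (induction "card S" arbitrary: S rule: less_induct)
  case less
  show ?case
  proof (cases "S = {}")
    case True
    then show ?thesis by auto
  next
    case False
    then obtain w where w: "w \<in> S" "card {w'\<in>S. (w, w') \<in> A} < d" using less.prems by blast
    define N where "N = insert w {w'\<in>S. (w, w') \<in> A}"
    have finN: "finite N" "N \<subseteq> S" "card N \<le> d"
      using w less.prems(1) unfolding N_def by (auto simp: card_insert_if)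
    have "S - N \<subset> S" using w unfolding N_def by auto
    then have "card (S - N) < card S" using less.prems(1) psubset_card_mono by blast
    then obtain I where I: "I \<subseteq> S - N" "I \<times> I \<inter> A \<subseteq> Id" "card (S - N) \<le> d * card I"
      using less.hyps[of "S - N"] less.prems by (meson Diff_subset finite_Diff subset_trans)
    have fI: "finite I" using I less.prems(1) finite_subset by blast
    have wI: "w \<notin> I" using I unfolding N_def by auto
    have "insert w I \<times> insert w I \<inter> A \<subseteq> Id"
      using I(1,2) symD[OF assms(2)] unfolding N_def by blast
    moreover have "card S \<le> d * card (insert w I)"
    proof -
      have "card S = card N + card (S - N)"
        using finN less.prems(1) card_Diff_subset[of N S] card_mono[of S N] by simp
      then show ?thesis using I(3) finN(3) fI wI by simp
    qed
    ultimately show ?thesis using w(1) I(1) by (intro exI[of _ "insert w I"]) auto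
  qed
qed

section \<open>Counting in random graphs of bounded out-degree\<close>

text \<open>
  The underlying simple graph of the digraph in which each \<open>x < N\<close> has the arcs \<open>x \<rightarrow> f (x, i)\<close> for
  \<open>i < m\<close>. Loops are dropped and repeated arcs are merged. Drawing all values of \<open>f\<close> independently keeps
  the counting elementary, at the price that in-degrees are bounded only on average.
\<close>

definition arc_fun_graph :: "nat \<Rightarrow> nat \<Rightarrow> (nat \<times> nat \<Rightarrow> nat) \<Rightarrow> nat rel" where
  "arc_fun_graph N m f =
     {(x, y). x < N \<and> y < N \<and> x \<noteq> y \<and> (\<exists>i<m. f (x, i) = y \<or> f (y, i) = x)}"

abbreviation arc_funs :: "nat \<Rightarrow> nat \<Rightarrow> (nat \<times> nat \<Rightarrow> nat) set" where
  "arc_funs N m \<equiv> ({..<N} \<times> {..<m}) \<rightarrow>\<^sub>E {..<N}"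

text \<open>
  The counting form of independence: constraints on the values at the places in \<open>A\<close>, each met by at most
  \<open>b\<close> of the possible values, are met simultaneously by at most a fraction \<open>(b / card V) ^ card A\<close> of all
  functions.
\<close>

lemma card_constrained_funs_le:
  assumes "finite P" "finite V" "A \<subseteq> P" and b: "\<And>p. p \<in> A \<Longrightarrow> card (B p \<inter> V) \<le> b"
  shows "card {f \<in> P \<rightarrow>\<^sub>E V. \<forall>p\<in>A. f p \<in> B p} \<le> b ^ card A * card V ^ (card P - card A)"
proof -
  have "{f \<in> P \<rightarrow>\<^sub>E V. \<forall>p\<in>A. f p \<in> B p} = (\<Pi>\<^sub>E p\<in>P. if p \<in> A then B p \<inter> V else V)"
    using assms(3) by (auto simp: PiE_iff extensional_def split: if_splits)
  then have "card {f \<in> P \<rightarrow>\<^sub>E V. \<forall>p\<in>A. f p \<in> B p} = (\<Prod>p\<in>P. card (if p \<in> A then B p \<inter> V else V))"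
    using assms(1) by (simp add: card_PiE)
  also have "\<dots> = (\<Prod>p\<in>A. card (if p \<in> A then B p \<inter> V else V)) *
      (\<Prod>p\<in>P - A. card (if p \<in> A then B p \<inter> V else V))"
    using assms(1,3) by (simp add: prod.subset_diff mult.commute)
  also have "(\<Prod>p\<in>A. card (if p \<in> A then B p \<inter> V else V)) \<le> (\<Prod>p\<in>A. b)"
    by (rule prod_mono) (use b in auto)
  also have "(\<Prod>p\<in>P - A. card (if p \<in> A then B p \<inter> V else V)) = card V ^ (card P - card A)"
    using assms(1,3) by (simp add: card_Diff_subset finite_subset)
  finally show ?thesis by simp
qed

text \<open>
  In an independent set \<open>S\<close> each of the \<open>t * m\<close> arcs that leave \<open>S\<close> avoids the \<open>t - 1\<close> other vertices of
  \<open>S\<close>; only a loop may end in \<open>S\<close>.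
\<close>

lemma arc_fun_graph_independent_count:
  assumes S: "S \<subseteq> {..<N}" "card S = t" "0 < t"
  shows "card {f \<in> arc_funs N m. S \<times> S \<inter> arc_fun_graph N m f = {}}
    \<le> (N - (t - 1)) ^ (t * m) * N ^ (N * m - t * m)"
proof -
  have finS: "finite S" using S finite_subset by blast
  have "card {f \<in> arc_funs N m. S \<times> S \<inter> arc_fun_graph N m f = {}}
    \<le> card {f \<in> arc_funs N m. \<forall>p\<in>S \<times> {..<m}. f p \<in> - (S - {fst p})}"
  proof (rule card_mono)
    show "finite {f \<in> arc_funs N m. \<forall>p\<in>S \<times> {..<m}. f p \<in> - (S - {fst p})}"
      by (rule finite_subset[of _ "arc_funs N m"]) (auto intro: finite_PiE)
    show "{f \<in> arc_funs N m. S \<times> S \<inter> arc_fun_graph N m f = {}}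
      \<subseteq> {f \<in> arc_funs N m. \<forall>p\<in>S \<times> {..<m}. f p \<in> - (S - {fst p})}"
    proof -
      have "f (x, i) \<in> - (S - {x})"
        if f: "S \<times> S \<inter> arc_fun_graph N m f = {}" and x: "x \<in> S" "i < m" for f x i
      proof
        assume *: "f (x, i) \<in> S - {x}"
        then have "(x, f (x, i)) \<in> arc_fun_graph N m f"
          using x S(1) unfolding arc_fun_graph_def by auto
        then show False using f x * by blast
      qed
      then show ?thesis by auto
    qed
  qed
  also have "\<dots> \<le> (N - (t - 1)) ^ card (S \<times> {..<m}) *
      card {..<N} ^ (card ({..<N} \<times> {..<m}) - card (S \<times> {..<m}))"
  proof (rule card_constrained_funs_le)
    fix p assume "p \<in> S \<times> {..<m}"
    then have p: "fst p \<in> S" by auto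
    have "- (S - {fst p}) \<inter> {..<N} = {..<N} - (S - {fst p})" by auto
    also have "card \<dots> = N - (t - 1)"
      using S finS p by (subst card_Diff_subset) (auto simp: card_Diff_singleton)
    finally show "card (- (S - {fst p}) \<inter> {..<N}) \<le> N - (t - 1)" by simp
  qed (use S in auto)
  finally show ?thesis using S by (simp add: card_cartesian_product)
qed

lemma list_cycle_nth:
  assumes "list_cycle E xs" "j < length xs"
  shows "(xs ! j, xs ! (Suc j mod length xs)) \<in> E"
proof (cases "Suc j < length xs")
  case True
  then show ?thesis using assms by (auto simp: list_cycle_def successively_conv_nth)
next
  case False
  then have "Suc j = length xs" using assms(2) by simp
  moreover from this have "xs \<noteq> []" by auto
  ultimately have "last xs = xs ! j" "hd xs = xs ! 0"
    using last_conv_nth[of xs] hd_conv_nth[of xs] by (metis diff_Suc_1, simp)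
  with \<open>Suc j = length xs\<close> show ?thesis using assms(1) by (simp add: list_cycle_def)
qed

text \<open>
  This fails for two vertices, where the cycle would use the same edge twice. It guarantees that the
  edges of a cycle are drawn independently of each other.
\<close>

lemma cyclic_pair_inj:
  assumes "distinct xs" "3 \<le> length xs" "j < length xs" "k < length xs"
    and "{xs ! j, xs ! (Suc j mod length xs)} = {xs ! k, xs ! (Suc k mod length xs)}"
  shows "j = k"
proof -
  have lt: "Suc i mod length xs < length xs" for i
    by (rule mod_less_divisor) (use assms(2) in linarith)
  have "{j, Suc j mod length xs} = {k, Suc k mod length xs}"
    using assms lt by (auto simp: doubleton_eq_iff nth_eq_iff_index_eq)
  then show ?thesis
    using assms(2,3,4) by (auto simp: doubleton_eq_iff mod_Suc split: if_splits)
qed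

text \<open>
  The average number of cycles of length \<open>l\<close> is at most \<open>(2 * m) ^ l\<close>, whatever \<open>N\<close> is: there are at most
  \<open>N ^ l\<close> vertex sequences and \<open>(2 * m) ^ l\<close> ways to assign to the edges an orientation and an arc index,
  and each combination prescribes \<open>l\<close> distinct values of \<open>f\<close>, which has probability \<open>1 / N ^ l\<close>.
\<close>

lemma short_cycle_total_count:
  assumes l: "3 \<le> l" and N: "0 < N"
  shows "(\<Sum>f\<in>arc_funs N m. card {xs. list_cycle (arc_fun_graph N m f) xs \<and> length xs = l})
    \<le> (2 * m) ^ l * card (arc_funs N m)"
proof -
  let ?F = "arc_funs N m"
  let ?P = "{..<N} \<times> {..<m}"
  define X where "X = {xs. set xs \<subseteq> {..<N} \<and> length xs = l}"
  define Es where "Es = {es. set es \<subseteq> {..<m} \<times> (UNIV :: bool set) \<and> length es = l}"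
  define src where "src = (\<lambda>(xs :: nat list) j (e :: nat \<times> bool).
    (if snd e then xs ! j else xs ! (Suc j mod l), fst e))"
  define tgt where "tgt = (\<lambda>(xs :: nat list) j (e :: nat \<times> bool).
    if snd e then xs ! (Suc j mod l) else xs ! j)"
  define cmp where "cmp = (\<lambda>f xs es. distinct xs \<and> (\<forall>j<l. f (src xs j (es ! j)) = tgt xs j (es ! j)))"
  have finF: "finite ?F" by (auto intro: finite_PiE)
  have finX: "finite X" unfolding X_def using finite_lists_length_eq[of "{..<N}" l] by simp
  have finO: "finite Es" unfolding Es_def
    using finite_lists_length_eq[of "{..<m} \<times> (UNIV :: bool set)" l] by simp
  have cardX: "card X = N ^ l" unfolding X_def using card_lists_length_eq[of "{..<N}" l] by simp
  have cardO: "card Es = (2 * m) ^ l" unfolding Es_def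
    using card_lists_length_eq[of "{..<m} \<times> (UNIV :: bool set)" l]
    by (simp add: card_cartesian_product mult.commute)
  (* Every cycle is traced by arcs of f, each traversed forwards or backwards. *)
  have traced: "card {xs. list_cycle (arc_fun_graph N m f) xs \<and> length xs = l}
      \<le> card {z \<in> X \<times> Es. cmp f (fst z) (snd z)}" for f
  proof -
    have "{xs. list_cycle (arc_fun_graph N m f) xs \<and> length xs = l}
      \<subseteq> fst ` {z \<in> X \<times> Es. cmp f (fst z) (snd z)}"
    proof
      fix xs assume "xs \<in> {xs. list_cycle (arc_fun_graph N m f) xs \<and> length xs = l}"
      then have xs: "list_cycle (arc_fun_graph N m f) xs" "length xs = l" by auto
      have arc: "(xs ! j, xs ! (Suc j mod l)) \<in> arc_fun_graph N m f" if "j < l" for j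
        using list_cycle_nth[OF xs(1)] xs(2) that by simp
      have "\<exists>e. fst e < m \<and> f (src xs j e) = tgt xs j e" if "j < l" for j
      proof -
        have "\<exists>i<m. f (xs ! j, i) = xs ! (Suc j mod l) \<or> f (xs ! (Suc j mod l), i) = xs ! j"
          using arc[OF \<open>j < l\<close>] by (simp add: arc_fun_graph_def)
        then obtain i where "i < m" "f (xs ! j, i) = xs ! (Suc j mod l) \<or> f (xs ! (Suc j mod l), i) = xs ! j"
          by blast
        then have "fst (i, True) < m \<and> f (src xs j (i, True)) = tgt xs j (i, True) \<or>
          fst (i, False) < m \<and> f (src xs j (i, False)) = tgt xs j (i, False)"
          unfolding src_def tgt_def by simp
        then show ?thesis by blast
      qed
      then obtain ob where ob: "fst (ob j) < m" "f (src xs j (ob j)) = tgt xs j (ob j)" if "j < l" for j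
        by metis
      define es where "es = map ob [0..<l]"
      have "set xs \<subseteq> {..<N}"
      proof
        fix y assume "y \<in> set xs"
        then obtain j where "j < l" "y = xs ! j" using xs(2) by (metis in_set_conv_nth)
        then show "y \<in> {..<N}" using arc unfolding arc_fun_graph_def by auto
      qed
      then have "xs \<in> X" using xs unfolding X_def by auto
      moreover have "set es \<subseteq> {..<m} \<times> UNIV"
        using ob(1) unfolding es_def by (simp add: image_subset_iff mem_Times_iff)
      then have "es \<in> Es" unfolding Es_def es_def by simp
      moreover have "cmp f xs es"
        using xs ob unfolding cmp_def src_def tgt_def es_def list_cycle_def by auto
      ultimately show "xs \<in> fst ` {z \<in> X \<times> Es. cmp f (fst z) (snd z)}" by force
    qed
    then show ?thesis using finX finO by (intro surj_card_le) auto
  qed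
  have each: "card {f \<in> ?F. cmp f xs es} * N ^ l \<le> N ^ (N * m)"
    if xs: "xs \<in> X" and es: "es \<in> Es" for xs es
  proof (cases "{f \<in> ?F. cmp f xs es} = {}")
    case False
    then obtain f where f: "cmp f xs es" by blast
    (* Arcs at the same place of f have the same ends, hence they trace the same edge of the cycle. *)
    have inj: "inj_on (\<lambda>j. src xs j (es ! j)) {..<l}"
    proof (rule inj_onI)
      fix j k assume jk: "j \<in> {..<l}" "k \<in> {..<l}" "src xs j (es ! j) = src xs k (es ! k)"
      then have "tgt xs j (es ! j) = tgt xs k (es ! k)" using f unfolding cmp_def by (metis lessThan_iff)
      then have "{xs ! j, xs ! (Suc j mod l)} = {xs ! k, xs ! (Suc k mod l)}"
        using jk(3) unfolding src_def tgt_def by (auto split: if_splits)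
      then show "j = k"
        using cyclic_pair_inj[of xs j k] f jk xs l unfolding cmp_def X_def by auto
    qed
    define A where "A = (\<lambda>j. src xs j (es ! j)) ` {..<l}"
    have A: "A \<subseteq> ?P"
    proof
      fix p assume "p \<in> A"
      then obtain j where j: "j < l" "p = src xs j (es ! j)" unfolding A_def by blast
      have "Suc j mod l < l" by (rule mod_less_divisor) (use l in linarith)
      then have "xs ! j \<in> set xs" "xs ! (Suc j mod l) \<in> set xs"
        using xs j(1) unfolding X_def by auto
      then have "xs ! j \<in> {..<N}" "xs ! (Suc j mod l) \<in> {..<N}"
        using xs unfolding X_def by blast+
      moreover have "fst (es ! j) < m"
      proof -
        have "es ! j \<in> set es" using es j(1) unfolding Es_def by auto
        then have "es ! j \<in> {..<m} \<times> UNIV" using es unfolding Es_def by blast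
        then show ?thesis by (simp add: mem_Times_iff)
      qed
      ultimately show "p \<in> ?P" using j unfolding src_def by auto
    qed
    have cardA: "card A = l" unfolding A_def using inj by (simp add: card_image)
    have lP: "l \<le> N * m" using card_mono[OF _ A] cardA by (simp add: card_cartesian_product)
    define B where "B = (\<lambda>p. {tgt xs j (es ! j) | j. j < l \<and> src xs j (es ! j) = p})"
    have B: "B (src xs j (es ! j)) = {tgt xs j (es ! j)}" if "j < l" for j
      using that inj_onD[OF inj] unfolding B_def by fastforce
    have "card {f \<in> ?F. cmp f xs es} \<le> card {f \<in> ?F. \<forall>p\<in>A. f p \<in> B p}"
    proof (rule card_mono)
      show "finite {f \<in> ?F. \<forall>p\<in>A. f p \<in> B p}" using finF by simp
      show "{f \<in> ?F. cmp f xs es} \<subseteq> {f \<in> ?F. \<forall>p\<in>A. f p \<in> B p}"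
        using B unfolding A_def cmp_def by auto
    qed
    also have "\<dots> \<le> 1 ^ card A * card {..<N} ^ (card ?P - card A)"
    proof (rule card_constrained_funs_le)
      fix p assume "p \<in> A"
      then obtain y where "B p = {y}" using B unfolding A_def by blast
      then show "card (B p \<inter> {..<N}) \<le> 1"
        using card_mono[of "{y}" "B p \<inter> {..<N}"] by simp
    qed (use A in auto)
    finally have "card {f \<in> ?F. cmp f xs es} * N ^ l \<le> N ^ (N * m - l) * N ^ l"
      by (simp add: cardA card_cartesian_product)
    also have "\<dots> = N ^ (N * m)" using lP by (simp flip: power_add)
    finally show ?thesis .
  qed (simp only: card.empty)
  have "(\<Sum>f\<in>?F. card {xs. list_cycle (arc_fun_graph N m f) xs \<and> length xs = l})
    \<le> (\<Sum>f\<in>?F. card {z \<in> X \<times> Es. cmp f (fst z) (snd z)})"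
    by (rule sum_mono) (rule traced)
  also have "\<dots> = (\<Sum>f\<in>?F. \<Sum>z\<in>X \<times> Es. if cmp f (fst z) (snd z) then 1 else 0)"
    using finX finO by (simp add: sum.If_cases Int_def)
  also have "\<dots> = (\<Sum>z\<in>X \<times> Es. \<Sum>f\<in>?F. if cmp f (fst z) (snd z) then 1 else 0)"
    by (rule sum.swap)
  also have "\<dots> = (\<Sum>z\<in>X \<times> Es. card {f \<in> ?F. cmp f (fst z) (snd z)})"
    using finF by (simp add: sum.If_cases Int_def)
  finally have "(\<Sum>f\<in>?F. card {xs. list_cycle (arc_fun_graph N m f) xs \<and> length xs = l}) * N ^ l
    \<le> (\<Sum>z\<in>X \<times> Es. card {f \<in> ?F. cmp f (fst z) (snd z)} * N ^ l)"
    by (simp add: sum_distrib_right[symmetric])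
  also have "\<dots> \<le> (\<Sum>z\<in>X \<times> Es. N ^ (N * m))"
    by (rule sum_mono) (use each in auto)
  also have "\<dots> = ((2 * m) ^ l * card ?F) * N ^ l"
    by (simp add: card_cartesian_product cardX cardO card_PiE)
  finally show ?thesis using N by simp
qed

text \<open>
  A consequence of Bernoulli's inequality \<open>(a + b) ^ k \<ge> a ^ k + k * a ^ (k - 1) * b\<close>, in a form without
  division.
\<close>

lemma two_mul_power_le:
  fixes a b k :: nat
  assumes "0 < k" "a \<le> k * b"
  shows "2 * a ^ k \<le> (a + b) ^ k"
proof -
  have B: "a ^ Suc k + Suc k * a ^ k * b \<le> (a + b) ^ Suc k" for k
  proof (induction k)
    case (Suc k)
    have "a ^ Suc (Suc k) + Suc (Suc k) * a ^ Suc k * b \<le> (a + b) * (a ^ Suc k + Suc k * a ^ k * b)"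
      by (simp add: algebra_simps)
    also have "\<dots> \<le> (a + b) * (a + b) ^ Suc k" using Suc by (rule mult_left_mono) simp
    finally show ?case by simp
  qed simp
  show ?thesis
  proof (cases k)
    case 0
    then show ?thesis using assms by simp
  next
    case (Suc j)
    have "a * a ^ j \<le> (k * b) * a ^ j" using assms(2) by (rule mult_right_mono) simp
    then show ?thesis using B[of j] Suc by (simp add: algebra_simps)
  qed
qed

text \<open>
  Union bound over the at most \<open>2 ^ N\<close> sets of size \<open>t\<close>. Since \<open>(t - 1) / N\<close> is at least \<open>1 / (2 * q)\<close>,
  every \<open>2 * q\<close> of the arcs leaving a fixed set halve the probability that it is independent. The choice
  of \<open>m\<close> provides \<open>t * m = 2 * q * (2 * N)\<close> such arcs, so this probability is at most \<open>2 ^ - (2 * N)\<close>.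
\<close>

lemma dense_funs_count:
  assumes q: "1 \<le> q" and t: "2 \<le> t" and N: "N = q * t" and m: "m = 4 * q\<^sup>2"
  shows "2 * card {f \<in> arc_funs N m. \<exists>S\<subseteq>{..<N}. card S = t \<and> S \<times> S \<inter> arc_fun_graph N m f = {}}
    \<le> card (arc_funs N m)"
proof -
  let ?a = "N - (t - 1)"
  let ?Ss = "{S. S \<subseteq> {..<N} \<and> card S = t}"
  let ?bad = "\<lambda>S. {f \<in> arc_funs N m. S \<times> S \<inter> arc_fun_graph N m f = {}}"
  have tN: "t \<le> N" using q N by simp
  have finF: "finite (arc_funs N m)" by (auto intro: finite_PiE)
  have "{f \<in> arc_funs N m. \<exists>S\<subseteq>{..<N}. card S = t \<and> S \<times> S \<inter> arc_fun_graph N m f = {}}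
    = (\<Union>S\<in>?Ss. ?bad S)" by auto
  then have "card {f \<in> arc_funs N m. \<exists>S\<subseteq>{..<N}. card S = t \<and> S \<times> S \<inter> arc_fun_graph N m f = {}}
    \<le> (\<Sum>S\<in>?Ss. card (?bad S))"
    using card_UN_le[of ?Ss ?bad] by simp
  also have "\<dots> \<le> (\<Sum>S\<in>?Ss. ?a ^ (t * m) * N ^ (N * m - t * m))"
    by (rule sum_mono) (use arc_fun_graph_independent_count t in auto)
  also have "\<dots> = card ?Ss * (?a ^ (t * m) * N ^ (N * m - t * m))" by simp
  also have "\<dots> \<le> 2 ^ N * (?a ^ (t * m) * N ^ (N * m - t * m))"
  proof (rule mult_right_mono)
    have "card ?Ss \<le> card (Pow {..<N})" by (rule card_mono) auto
    then show "card ?Ss \<le> 2 ^ N" by (simp add: card_Pow)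
  qed simp
  finally have *: "2 * card {f \<in> arc_funs N m. \<exists>S\<subseteq>{..<N}. card S = t \<and> S \<times> S \<inter> arc_fun_graph N m f = {}}
    \<le> 2 * 2 ^ N * ?a ^ (t * m) * N ^ (N * m - t * m)" by simp
  have "t \<le> 2 * (t - 1)" using t by simp
  then have "q * t \<le> q * (2 * (t - 1))" by (rule mult_left_mono) simp
  also have "\<dots> = (2 * q) * (t - 1)" by simp
  finally have "?a \<le> (2 * q) * (t - 1)" using N by linarith
  then have "2 * ?a ^ (2 * q) \<le> (?a + (t - 1)) ^ (2 * q)"
    using q by (intro two_mul_power_le) auto
  also have "?a + (t - 1) = N" using tN by simp
  finally have "(2 * ?a ^ (2 * q)) ^ (2 * N) \<le> (N ^ (2 * q)) ^ (2 * N)" by (rule power_mono) simp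
  moreover have tm: "2 * q * (2 * N) = t * m" unfolding N m by (simp add: power2_eq_square)
  ultimately have "2 ^ (2 * N) * ?a ^ (t * m) \<le> N ^ (t * m)"
    by (simp add: power_mult_distrib flip: power_mult)
  moreover have "(2::nat) * 2 ^ N \<le> 2 ^ (2 * N)"
  proof -
    have "(2::nat) ^ Suc N \<le> 2 ^ (2 * N)" by (rule power_increasing) (use tN t in auto)
    then show ?thesis by simp
  qed
  ultimately have "2 * 2 ^ N * ?a ^ (t * m) \<le> N ^ (t * m)"
    by (meson mult_right_mono order_trans zero_le)
  then have "2 * 2 ^ N * ?a ^ (t * m) * N ^ (N * m - t * m) \<le> N ^ (t * m) * N ^ (N * m - t * m)"
    by (rule mult_right_mono) simp
  also have "\<dots> = N ^ (N * m)"
    using tN by (simp add: flip: power_add)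
  also have "\<dots> = card (arc_funs N m)" by (simp add: card_PiE)
  finally show ?thesis using * by linarith
qed

text \<open>
  At least half of all functions have no large independent set, so one of them has at most twice the
  average number of short cycles. That number is bounded by a constant depending only on \<open>m\<close> and \<open>g\<close>,
  hence it is a small fraction of \<open>N = q * t\<close> if \<open>t\<close> is large.
\<close>

lemma ex_arc_fun:
  fixes g q :: nat
  assumes q: "1 \<le> q" and m: "m = 4 * q\<^sup>2"
  shows "\<exists>t f. 0 < t \<and> f \<in> arc_funs (q * t) m \<and>
    (\<forall>S\<subseteq>{..<q * t}. card S = t \<longrightarrow> S \<times> S \<inter> arc_fun_graph (q * t) m f \<noteq> {}) \<and>
    4 * card {xs. list_cycle (arc_fun_graph (q * t) m f) xs \<and> length xs \<le> g} \<le> q * t"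
proof -
  (* C bounds the average number of short cycles; t makes twice C at most N / 4. *)
  define C where "C = (\<Sum>l=3..g. (2 * m) ^ l)"
  define t where "t = 8 * C + 2"
  define N where "N = q * t"
  let ?F = "arc_funs N m"
  let ?cyc = "\<lambda>f. {xs. list_cycle (arc_fun_graph N m f) xs \<and> length xs \<le> g}"
  let ?cl = "\<lambda>f l. {xs. list_cycle (arc_fun_graph N m f) xs \<and> length xs = l}"
  define Bad where "Bad = {f \<in> ?F. \<exists>S\<subseteq>{..<N}. card S = t \<and> S \<times> S \<inter> arc_fun_graph N m f = {}}"
  have t: "2 \<le> t" unfolding t_def by simp
  have tN: "t \<le> N" unfolding N_def using q by simp
  have N0: "0 < N" using t tN by simp
  have finF: "finite ?F" by (auto intro: finite_PiE)
  have F0: "0 < card ?F" using N0 by (simp add: card_PiE)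
  have bad: "2 * card Bad \<le> card ?F"
    unfolding Bad_def by (rule dense_funs_count[OF q t N_def m])
  have "(\<Sum>f\<in>?F. card (?cyc f)) \<le> (\<Sum>f\<in>?F. \<Sum>l=3..g. card (?cl f l))"
  proof (rule sum_mono)
    fix f
    have "?cyc f = (\<Union>l\<in>{3..g}. ?cl f l)" unfolding list_cycle_def by auto
    then show "card (?cyc f) \<le> (\<Sum>l=3..g. card (?cl f l))"
      using card_UN_le[of "{3..g}" "?cl f"] by simp
  qed
  also have "\<dots> = (\<Sum>l=3..g. \<Sum>f\<in>?F. card (?cl f l))" by (rule sum.swap)
  also have "\<dots> \<le> (\<Sum>l=3..g. (2 * m) ^ l * card ?F)"
    by (rule sum_mono) (use short_cycle_total_count N0 in auto)
  also have "\<dots> = C * card ?F" unfolding C_def by (simp add: sum_distrib_right)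
  finally have total: "(\<Sum>f\<in>?F. card (?cyc f)) \<le> C * card ?F" .
  have "\<exists>f\<in>?F - Bad. card (?cyc f) \<le> 2 * C"
  proof (rule ccontr)
    assume "\<not> ?thesis"
    then have many: "2 * C + 1 \<le> card (?cyc f)" if "f \<in> ?F - Bad" for f using that by force
    have "card ?F \<le> 2 * card (?F - Bad)"
      using bad finF by (subst card_Diff_subset) (auto simp: Bad_def)
    then have "card ?F * (2 * C + 1) \<le> 2 * card (?F - Bad) * (2 * C + 1)"
      by (rule mult_right_mono) simp
    also have "\<dots> = 2 * (\<Sum>f\<in>?F - Bad. 2 * C + 1)" by simp
    also have "\<dots> \<le> 2 * (\<Sum>f\<in>?F - Bad. card (?cyc f))"
      using many by (intro mult_left_mono sum_mono) auto
    also have "\<dots> \<le> 2 * (\<Sum>f\<in>?F. card (?cyc f))"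
      using finF by (intro mult_left_mono sum_mono2) auto
    also have "\<dots> \<le> 2 * (C * card ?F)" using total by simp
    finally show False using F0 by (simp add: algebra_simps)
  qed
  then obtain f where f: "f \<in> ?F" "f \<notin> Bad" "card (?cyc f) \<le> 2 * C" by blast
  have "4 * card (?cyc f) \<le> t" using f(3) unfolding t_def by linarith
  then have "4 * card (?cyc f) \<le> N" using tN by linarith
  then show ?thesis using f t unfolding Bad_def N_def by (intro exI[of _ t] exI[of _ f]) auto
qed

text \<open>
  Deleting the vertices of in-degree above \<open>4 * m\<close>, of which there are at most \<open>N / 4\<close> because the average
  in-degree is \<open>m\<close>, and one vertex of each short cycle, again at most \<open>N / 4\<close>, keeps half of the vertices.
  Degrees are then at most \<open>m + 4 * m = 20 * q\<^sup>2\<close>, for every \<open>g\<close>.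
\<close>

lemma sparse_host:
  fixes q g :: nat
  assumes q: "1 \<le> q"
  shows "\<exists>(V :: nat set) A. finite V \<and> V \<noteq> {} \<and> A \<subseteq> V \<times> V \<and> sym A \<and> irrefl A \<and>
    (\<forall>v\<in>V. card {w. (v, w) \<in> A} \<le> 20 * q\<^sup>2) \<and>
    (\<forall>xs. list_cycle A xs \<longrightarrow> g < length xs) \<and>
    (\<forall>I\<subseteq>V. I \<times> I \<inter> A = {} \<longrightarrow> q * card I < 2 * card V)"
proof -
  define m where "m = 4 * q\<^sup>2"
  obtain t f where t: "0 < t" and f: "f \<in> arc_funs (q * t) m"
    and dense: "\<And>S. S \<subseteq> {..<q * t} \<Longrightarrow> card S = t \<Longrightarrow> S \<times> S \<inter> arc_fun_graph (q * t) m f \<noteq> {}"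
    and few: "4 * card {xs. list_cycle (arc_fun_graph (q * t) m f) xs \<and> length xs \<le> g} \<le> q * t"
    using ex_arc_fun[OF q m_def, of g] by blast
  define N where "N = q * t"
  define G where "G = arc_fun_graph N m f"
  define P where "P = {..<N} \<times> {..<m}"
  define Short where "Short = {xs. list_cycle G xs \<and> length xs \<le> g}"
  define High where "High = {y \<in> {..<N}. 4 * m < card {p \<in> P. f p = y}}"
  define V where "V = {..<N} - High - hd ` Short"
  define A where "A = G \<inter> V \<times> V"
  have m0: "0 < m" unfolding m_def using q by simp
  have N0: "0 < N" unfolding N_def using q t by simp
  have finP: "finite P" unfolding P_def by simp
  have GN: "G \<subseteq> {..<N} \<times> {..<N}" unfolding G_def arc_fun_graph_def by auto
  have sub: "set xs \<subseteq> {..<N}" if "list_cycle G xs" for xs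
  proof
    fix y assume "y \<in> set xs"
    then obtain j where "j < length xs" "y = xs ! j" by (metis in_set_conv_nth)
    then show "y \<in> {..<N}" using list_cycle_nth[OF that] GN by blast
  qed
  have finShort: "finite Short"
    by (rule finite_subset[OF _ finite_lists_length_le[of "{..<N}" g]]) (use sub in \<open>auto simp: Short_def\<close>)
  have "4 * m * card High \<le> (\<Sum>y\<in>High. card {p \<in> P. f p = y})"
    using sum_mono[of High "\<lambda>_. 4 * m" "\<lambda>y. card {p \<in> P. f p = y}"]
    by (simp add: High_def mult.commute)
  also have "\<dots> = card (\<Union>y\<in>High. {p \<in> P. f p = y})"
    by (rule card_UN_disjoint[symmetric]) (use finP in \<open>auto simp: High_def\<close>)
  also have "\<dots> \<le> card P" using finP by (intro card_mono) auto
  also have "\<dots> = N * m" unfolding P_def by (simp add: card_cartesian_product)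
  finally have High: "4 * card High \<le> N" using m0 by (simp add: mult.commute mult.left_commute)
  have "N - card High - card (hd ` Short) \<le> card V"
    unfolding V_def using diff_card_le_card_Diff[of High "{..<N}"]
      diff_card_le_card_Diff[of "hd ` Short" "{..<N} - High"] finShort
    by (simp add: High_def)
  moreover have "card (hd ` Short) \<le> card Short" by (rule card_image_le) (rule finShort)
  moreover have "4 * card Short \<le> N" using few unfolding Short_def G_def N_def .
  (* The factor 2 in the bound on independent sets pays for the deleted vertices. *)
  ultimately have cardV: "N \<le> 2 * card V" using High by linarith
  have "card {w. (v, w) \<in> A} \<le> 20 * q\<^sup>2" if v: "v \<in> V" for v
  proof -
    have "{w. (v, w) \<in> A} \<subseteq> (\<lambda>i. f (v, i)) ` {..<m} \<union> fst ` {p \<in> P. f p = v}"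
      unfolding A_def G_def arc_fun_graph_def P_def by force
    then have "card {w. (v, w) \<in> A} \<le> card ((\<lambda>i. f (v, i)) ` {..<m} \<union> fst ` {p \<in> P. f p = v})"
      using finP by (intro card_mono) auto
    also have "\<dots> \<le> card ((\<lambda>i. f (v, i)) ` {..<m}) + card (fst ` {p \<in> P. f p = v})"
      by (rule card_Un_le)
    also have "\<dots> \<le> card {..<m} + card {p \<in> P. f p = v}"
      using finP by (intro add_mono card_image_le) auto
    also have "\<dots> \<le> m + 4 * m" using v unfolding V_def High_def by auto
    finally show ?thesis unfolding m_def by simp
  qed
  moreover have "g < length xs" if xs: "list_cycle A xs" for xs
  proof (rule ccontr)
    assume "\<not> g < length xs"
    moreover have "list_cycle G xs"
      using xs unfolding list_cycle_def A_def by (auto elim: successively_mono)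
    ultimately have "hd xs \<notin> V" unfolding V_def Short_def by auto
    moreover have "hd xs \<in> V" using xs unfolding list_cycle_def A_def by auto
    ultimately show False by blast
  qed
  moreover have "q * card I < 2 * card V" if I: "I \<subseteq> V" "I \<times> I \<inter> A = {}" for I
  proof -
    have "card I < t"
    proof (rule ccontr)
      assume "\<not> card I < t"
      then obtain S where S: "S \<subseteq> I" "card S = t"
        using obtain_subset_with_card_n[of t I] by (metis not_less)
      have "S \<times> S \<inter> G = {}" using S I unfolding A_def by blast
      moreover have "S \<subseteq> {..<N}" using S I unfolding V_def by blast
      ultimately show False using dense S unfolding G_def N_def by blast
    qed
    then have "q * card I < q * t" using q by simp
    then show ?thesis using cardV unfolding N_def by linarith
  qed
  moreover have "V \<noteq> {}" using cardV N0 by auto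
  moreover have "sym A" "irrefl A" "finite V" "A \<subseteq> V \<times> V"
    unfolding A_def G_def arc_fun_graph_def V_def by (auto simp: sym_def irrefl_def)
  ultimately show ?thesis by blast
qed

section \<open>Trees, degrees and copies of digraphs\<close>

text \<open>
  Connects vertex lists with the arc walks in which acyclicity of trees is expressed: the arcs of the
  cycle are the consecutive pairs of the list, with the first vertex repeated at the end.
\<close>

lemma list_cycle_imp_cycle:
  assumes G: "pair_wf_digraph G" and xs: "list_cycle (parcs G) xs"
  shows "\<exists>p. pre_digraph.cycle (with_proj G) p \<and> 3 \<le> length p"
proof -
  interpret pair_wf_digraph G by (rule G)
  let ?walk = "\<lambda>ys z. zip ys (tl ys @ [z])"
  have walk: "pcas (hd ys) (?walk ys z) z \<and> pawalk_verts u (?walk ys z) = ys @ [z]"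
    if "ys \<noteq> []" for ys :: "'a list" and u z
    using that
  proof (induction ys arbitrary: u)
    case (Cons y ys)
    then show ?case by (cases ys) auto
  qed simp
  have arcs: "set (?walk ys z) \<subseteq> parcs G"
    if "ys \<noteq> []" "successively (\<lambda>u v. (u, v) \<in> parcs G) ys" "(last ys, z) \<in> parcs G" for ys z
    using that
  proof (induction ys)
    case (Cons y ys)
    then show ?case by (cases ys) auto
  qed simp
  have ne: "xs \<noteq> []" using xs by (auto simp: list_cycle_def)
  have V: "hd xs \<in> pverts G" using xs in_arcsD2 by (auto simp: list_cycle_def)
  have "awalk (hd xs) (?walk xs (hd xs)) (hd xs)"
    unfolding awalk_def using V arcs[OF ne, of "hd xs"] walk[OF ne] xs
    by (auto simp: list_cycle_def)
  moreover have "distinct (tl xs @ [hd xs])" using xs ne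
    by (cases xs) (auto simp: list_cycle_def)
  then have "distinct (tl (pawalk_verts (hd xs) (?walk xs (hd xs))))"
    using walk[OF ne] ne by simp
  moreover have "length (?walk xs (hd xs)) = length xs" using ne by simp
  ultimately show ?thesis using xs ne
    unfolding cycle_def list_cycle_def
    by (intro exI[of _ "?walk xs (hd xs)"]) (metis length_0_conv)
qed

lemma connected_exits:
  assumes G: "pair_graph G" and conn: "connected (with_proj G)"
    and U: "U \<subset> pverts G" "U \<noteq> {}"
  shows "\<exists>u\<in>U. \<exists>x\<in>pverts G - U. (u, x) \<in> parcs G"
proof (rule ccontr)
  assume no: "\<not> ?thesis"
  interpret pair_graph G by (rule G)
  have sc: "strongly_connected (with_proj G)"
    using symmetric_connected_imp_strongly_connected[OF pair_sym_arcs conn] .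
  obtain u x where ux: "u \<in> U" "x \<in> pverts G" "x \<notin> U" using U by blast
  have "(u, x) \<in> rtrancl_on (pverts G) (parcs G)"
    using sc ux U unfolding strongly_connected_def reachable_def by auto
  then have "(u, x) \<in> (parcs G)\<^sup>*" by (rule rtrancl_on_rtranclI)
  then have "x \<in> U"
  proof (induction)
    case base
    then show ?case by (rule ux)
  next
    case (step y z)
    then show ?case using no in_arcsD2 by blast
  qed
  then show False using ux by blast
qed

lemma out_degree_with_proj:
  "out_degree (with_proj G) v = card {w. (v, w) \<in> parcs G}"
proof -
  have "out_arcs (with_proj G) v = Pair v ` {w. (v, w) \<in> parcs G}"
    by (auto simp: out_arcs_def)
  then show ?thesis unfolding out_degree_def by (simp add: card_image inj_on_def)
qed

lemma degree_le_max_degree: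
  assumes "finite (pverts G)" "v \<in> pverts G"
  shows "card {w. (v, w) \<in> parcs G} \<le> max_degree G"
  unfolding max_degree_def using assms by (intro Max_ge) (auto simp: out_degree_with_proj)

lemma max_degree_leI:
  assumes "finite (pverts G)" "\<And>v. v \<in> pverts G \<Longrightarrow> card {w. (v, w) \<in> parcs G} \<le> D"
  shows "max_degree G \<le> D"
  using assms unfolding max_degree_def by (auto simp: out_degree_with_proj)

lemma monochromatic_copyI:
  assumes G: "pair_wf_digraph G" and H: "pair_wf_digraph H"
    and inj: "inj_on \<psi> (pverts G)" and V: "\<psi> ` pverts G \<subseteq> pverts H"
    and E: "\<And>u v. (u, v) \<in> parcs G \<Longrightarrow> (\<psi> u, \<psi> v) \<in> parcs H"
    and mono: "\<And>u v. u \<in> pverts G \<Longrightarrow> v \<in> pverts G \<Longrightarrow> \<chi> (\<psi> u) = \<chi> (\<psi> v)"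
  shows "monochromatic_copy G H \<chi>"
proof -
  interpret G: pair_wf_digraph G by (rule G)
  interpret H: pair_wf_digraph H by (rule H)
  define K where "K = \<lparr>pverts = \<psi> ` pverts G, parcs = map_prod \<psi> \<psi> ` parcs G\<rparr>"
  interpret K: pair_wf_digraph K
    by unfold_locales (auto simp: K_def dest: G.wellformed')
  have "subgraph (with_proj K) (with_proj H)"
    unfolding subgraph_def compatible_def
    using V E K.wf_digraph H.wf_digraph by (auto simp: K_def)
  moreover have "digraph_iso (with_proj G) (with_proj K)"
    unfolding digraph_iso_def
  proof (intro exI conjI)
    let ?h = "\<lparr>iso_verts = \<psi>, iso_arcs = map_prod \<psi> \<psi>, iso_head = snd, iso_tail = fst\<rparr>"
    have "inj_on (map_prod \<psi> \<psi>) (parcs G)"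
      by (rule inj_on_subset[OF map_prod_inj_on[OF inj inj]]) (auto dest: G.wellformed')
    then show "pre_digraph.digraph_isomorphism (with_proj G) ?h"
      unfolding pre_digraph.digraph_isomorphism_def using G.wf_digraph inj by auto
    show "with_proj K = app_iso ?h (with_proj G)"
      by (simp add: app_iso_def K_def with_proj_def)
  qed
  moreover have "\<forall>u \<in> pverts K. \<forall>v \<in> pverts K. \<chi> u = \<chi> v"
  proof (intro ballI)
    fix x y assume "x \<in> pverts K" "y \<in> pverts K"
    then obtain u v where "x = \<psi> u" "y = \<psi> v" "u \<in> pverts G" "v \<in> pverts G"
      by (auto simp: K_def)
    then show "\<chi> x = \<chi> y" using mono by blast
  qed
  ultimately show ?thesis unfolding monochromatic_copy_def by blast
qed

section \<open>Blowups of sparse hosts are Ramsey for tree blowups\<close>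

text \<open>
  The closed \<open>M\<close>-blowup of the graph \<open>(V, A)\<close> realised on natural numbers: the clique that replaces \<open>v\<close> is
  the interval of all \<open>a\<close> with \<open>a div M = v\<close>.
\<close>

definition nat_blowup :: "nat set \<Rightarrow> nat rel \<Rightarrow> nat \<Rightarrow> nat pair_pre_digraph" where
  "nat_blowup V A M = \<lparr>pverts = {a. a div M \<in> V},
     parcs = {(a, b). a div M \<in> V \<and> b div M \<in> V \<and> a \<noteq> b \<and>
       (a div M = b div M \<or> (a div M, b div M) \<in> A)}\<rparr>"

lemma div_fiber:
  assumes "0 < M"
  shows "finite {a :: nat. a div M = v}" "card {a :: nat. a div M = v} = M"
proof -
  have "{a. a div M = v} = {v * M..<v * M + M}"
  proof -
    have "a div M = v \<longleftrightarrow> v * M \<le> a \<and> a < Suc v * M" for a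
      using less_eq_div_iff_mult_less_eq[OF assms, of v a] div_less_iff_less_mult[OF assms, of a "Suc v"]
      by linarith
    then show ?thesis by (simp add: set_eq_iff add.commute)
  qed
  then show "finite {a :: nat. a div M = v}" "card {a :: nat. a div M = v} = M" by auto
qed

lemma finite_div_preimage:
  fixes V :: "nat set"
  assumes "0 < M" "finite V"
  shows "finite {a. a div M \<in> V}" "card {a. a div M \<in> V} \<le> card V * M"
proof -
  have *: "{a. a div M \<in> V} = (\<Union>v\<in>V. {a. a div M = v})" by auto
  show "finite {a. a div M \<in> V}" unfolding * using assms div_fiber by auto
  show "card {a. a div M \<in> V} \<le> card V * M"
    unfolding * using card_UN_le[OF assms(2), of "\<lambda>v. {a. a div M = v}"] div_fiber(2)[OF assms(1)] by simp
qed

lemma nat_blowup_graph: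
  assumes "0 < M" "finite V" "sym A"
  shows "pair_graph (nat_blowup V A M)"
proof -
  have "finite (parcs (nat_blowup V A M))"
    by (rule finite_subset[of _ "{a. a div M \<in> V} \<times> {a. a div M \<in> V}"])
      (use finite_div_preimage[OF assms(1,2)] in \<open>auto simp: nat_blowup_def\<close>)
  moreover have "sym (parcs (nat_blowup V A M))"
  proof (rule symI)
    fix a b assume "(a, b) \<in> parcs (nat_blowup V A M)"
    then show "(b, a) \<in> parcs (nat_blowup V A M)"
      using symD[OF assms(3), of "a div M" "b div M"] by (auto simp: nat_blowup_def)
  qed
  moreover have "finite (pverts (nat_blowup V A M))"
    using finite_div_preimage(1)[OF assms(1,2)] by (simp add: nat_blowup_def)
  moreover have "fst e \<in> pverts (nat_blowup V A M) \<and> snd e \<in> pverts (nat_blowup V A M) \<and> fst e \<noteq> snd e"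
    if "e \<in> parcs (nat_blowup V A M)" for e
    using that by (auto simp: nat_blowup_def)
  ultimately show ?thesis
    by unfold_locales (simp_all add: symmetric_def)
qed

lemma nat_blowup_max_degree:
  assumes "0 < M" "finite V" "A \<subseteq> V \<times> V" "\<And>v. v \<in> V \<Longrightarrow> card {w. (v, w) \<in> A} \<le> D"
  shows "max_degree (nat_blowup V A M) \<le> (D + 1) * M"
proof (rule max_degree_leI)
  show "finite (pverts (nat_blowup V A M))"
    using finite_div_preimage[OF assms(1,2)] by (simp add: nat_blowup_def)
  fix a assume a: "a \<in> pverts (nat_blowup V A M)"
  let ?N = "{w. (a div M, w) \<in> A}"
  have fin: "finite ?N" by (rule finite_subset[OF _ assms(2)]) (use assms(3) in auto)
  have "card {b. (a, b) \<in> parcs (nat_blowup V A M)} \<le> card {b. b div M \<in> insert (a div M) ?N}"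
    using finite_div_preimage(1)[OF assms(1), of "insert (a div M) ?N"] fin
    by (intro card_mono) (auto simp: nat_blowup_def)
  also have "\<dots> \<le> card (insert (a div M) ?N) * M"
    using fin by (intro finite_div_preimage assms) auto
  also have "\<dots> \<le> (D + 1) * M"
    using card_insert_le_m1[of "D + 1" ?N "a div M"] assms(4)[of "a div M"] a
    by (intro mult_right_mono) (auto simp: nat_blowup_def)
  finally show "card {b. (a, b) \<in> parcs (nat_blowup V A M)} \<le> (D + 1) * M" .
qed

lemma mem_closed_blowup:
  "(u, i) \<in> pverts (closed_blowup T k) \<longleftrightarrow> u \<in> pverts T \<and> i < k"
  "((u, i), (v, j)) \<in> parcs (closed_blowup T k) \<longleftrightarrow>
     u \<in> pverts T \<and> v \<in> pverts T \<and> i < k \<and> j < k \<and> (u = v \<and> i \<noteq> j \<or> (u, v) \<in> parcs T)"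
  unfolding closed_blowup_def by simp_all

lemma closed_blowup_graph:
  assumes "pair_graph T"
  shows "pair_wf_digraph (closed_blowup T k)"
proof -
  interpret pair_graph T by (rule assms)
  show ?thesis by unfold_locales (auto simp: closed_blowup_def)
qed

lemma majority_color:
  fixes \<chi> :: "'b \<Rightarrow> nat"
  assumes "finite F" "card F = s * k" "0 < s" "\<chi> ` F \<subseteq> {..<s}"
  shows "\<exists>c<s. k \<le> card {a \<in> F. \<chi> a = c}"
proof (rule ccontr)
  assume no: "\<not> ?thesis"
  have "F = (\<Union>c\<in>{..<s}. {a \<in> F. \<chi> a = c})" using assms(4) by auto
  then have "card F \<le> (\<Sum>c<s. card {a \<in> F. \<chi> a = c})"
    using card_UN_le[of "{..<s}" "\<lambda>c. {a \<in> F. \<chi> a = c}"] by simp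
  also have "\<dots> < (\<Sum>c<s. k)"
    using no assms(3) by (intro sum_strict_mono) (auto simp: not_le)
  finally show False using assms(2) by simp
qed

text \<open>
  Otherwise each of the \<open>s\<close> classes contains an independent set of at least a \<open>1 / d\<close> fraction of its size,
  hence has fewer than \<open>card V / s\<close> elements, and the classes could not cover \<open>V\<close>.
\<close>

lemma dense_color_class:
  fixes c :: "'b \<Rightarrow> nat"
  assumes "finite V" "sym A" "irrefl A" "0 < s" "c ` V \<subseteq> {..<s}"
    and ind: "\<And>I. I \<subseteq> V \<Longrightarrow> I \<times> I \<inter> A = {} \<Longrightarrow> s * d * card I < card V"
  shows "\<exists>W\<subseteq>V. W \<noteq> {} \<and> (\<forall>v\<in>W. d \<le> card {w\<in>W. (v, w) \<in> A}) \<and> (\<forall>v\<in>W. \<forall>w\<in>W. c v = c w)"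
proof (rule ccontr)
  assume no: "\<not> ?thesis"
  let ?cl = "\<lambda>j. {v \<in> V. c v = j}"
  have small: "s * card (?cl j) < card V" for j
  proof -
    have "\<exists>w\<in>W. card {w'\<in>W. (w, w') \<in> A} < d" if W: "W \<subseteq> ?cl j" "W \<noteq> {}" for W
    proof (rule ccontr)
      assume "\<not> ?thesis"
      then have "\<forall>v\<in>W. d \<le> card {w\<in>W. (v, w) \<in> A}" by (auto simp: not_less)
      moreover have "\<forall>v\<in>W. \<forall>w\<in>W. c v = c w" "W \<subseteq> V" using W by auto
      ultimately show False using no W(2) by blast
    qed
    then obtain I where I: "I \<subseteq> ?cl j" "I \<times> I \<inter> A \<subseteq> Id" "card (?cl j) \<le> d * card I"
      using independent_subset_if_degenerate[of "?cl j" A d] assms(1,2) by auto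
    have "I \<times> I \<inter> A = {}" using I(2) assms(3) by (auto simp: irrefl_def)
    then have "s * d * card I < card V" using I(1) by (intro ind) auto
    moreover have "s * card (?cl j) \<le> s * (d * card I)" using I(3) by (rule mult_left_mono) simp
    ultimately show ?thesis unfolding mult.assoc by linarith
  qed
  have "V = (\<Union>j\<in>{..<s}. ?cl j)" using assms(5) by auto
  then have "card V \<le> (\<Sum>j<s. card (?cl j))"
    using card_UN_le[of "{..<s}" ?cl] by simp
  then have "s * card V \<le> s * (\<Sum>j<s. card (?cl j))" by simp
  also have "\<dots> = (\<Sum>j<s. s * card (?cl j))" by (simp add: sum_distrib_left)
  also have "\<dots> < (\<Sum>j<s. card V)" using small assms(4) by (intro sum_strict_mono) auto
  finally show False by simp
qed

text \<open>
  With \<open>q = 2 * s * d\<close> the independent sets of the host are small enough for \<open>dense_color_class\<close>, and cliques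
  of size \<open>s * k\<close> are large enough to contain \<open>k\<close> vertices of one colour. The degree bound is explicit so
  that it visibly depends on nothing but \<open>d\<close>, \<open>s\<close> and \<open>k\<close>.
\<close>

lemma tree_blowup_host:
  fixes T :: "'a pair_pre_digraph"
  assumes d: "1 \<le> d" and s: "1 \<le> s" and k: "1 \<le> k"
    and T: "undirected_tree T" "max_degree T \<le> d"
  shows "\<exists>H :: nat pair_pre_digraph. pair_graph H \<and>
    max_degree H \<le> (20 * (2 * s * d)\<^sup>2 + 1) * (s * k) \<and> vertex_arrows H s (closed_blowup T k)"
proof -
  have GT: "pair_graph T" and conn: "connected (with_proj T)"
    and acyc: "\<not> (\<exists>p. pre_digraph.cycle (with_proj T) p \<and> 3 \<le> length p)"
    using T unfolding undirected_tree_def by auto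
  interpret T: pair_graph T by (rule GT)
  have symT: "sym (parcs T)" using T.pair_sym_arcs by (simp add: symmetric_def)
  have irrT: "irrefl (parcs T)" unfolding irrefl_def using T.pair_no_loops by fastforce
  have neT: "pverts T \<noteq> {}"
    using conn by (auto simp: connected_def strongly_connected_def)
  define M where "M = s * k"
  have M: "0 < M" unfolding M_def using s k by simp
  have q: "1 \<le> 2 * s * d" using s d by simp
  obtain V :: "nat set" and A where host: "finite V" "V \<noteq> {}" "A \<subseteq> V \<times> V" "sym A" "irrefl A"
    and deg: "\<And>v. v \<in> V \<Longrightarrow> card {w. (v, w) \<in> A} \<le> 20 * (2 * s * d)\<^sup>2"
    and girth: "\<And>xs. list_cycle A xs \<Longrightarrow> card (pverts T) < length xs"
    and ind: "\<And>I. I \<subseteq> V \<Longrightarrow> I \<times> I \<inter> A = {} \<Longrightarrow> 2 * s * d * card I < 2 * card V"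
    using sparse_host[OF q, of "card (pverts T)"]
    by (elim exE conjE, intro that) (assumption | erule (1) bspec | erule allE, erule (1) mp | erule allE, erule (1) impE, erule (1) mp)+
  let ?H = "nat_blowup V A M"
  have GH: "pair_graph ?H" by (rule nat_blowup_graph) (use M host in auto)
  interpret H: pair_graph ?H by (rule GH)
  have "vertex_arrows ?H s (closed_blowup T k)"
    unfolding vertex_arrows_def
  proof (intro allI impI)
    fix \<chi> :: "nat \<Rightarrow> nat" assume \<chi>: "\<chi> ` pverts ?H \<subseteq> {..<s}"
    have "\<exists>c<s. k \<le> card {a \<in> {a. a div M = v}. \<chi> a = c}" if "v \<in> V" for v
      by (rule majority_color)
        (use div_fiber[OF M, of v] s k \<chi> that in \<open>auto simp: M_def nat_blowup_def\<close>)
    (* The induced colouring of the host: a colour that is frequent in the clique of v. *)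
    then obtain c where c: "c v < s" "k \<le> card {a. a div M = v \<and> \<chi> a = c v}" if "v \<in> V" for v
      by simp metis
    have "\<exists>W\<subseteq>V. W \<noteq> {} \<and> (\<forall>v\<in>W. d \<le> card {w\<in>W. (v, w) \<in> A}) \<and> (\<forall>v\<in>W. \<forall>w\<in>W. c v = c w)"
    proof (rule dense_color_class)
      show "s * d * card I < card V" if "I \<subseteq> V" "I \<times> I \<inter> A = {}" for I
        using ind[OF that] by simp
    qed (use host s c in auto)
    then obtain W where W: "W \<subseteq> V" "W \<noteq> {}" "\<And>v. v \<in> W \<Longrightarrow> d \<le> card {w\<in>W. (v, w) \<in> A}"
      "\<And>v w. v \<in> W \<Longrightarrow> w \<in> W \<Longrightarrow> c v = c w"
      by blast
    have "\<exists>\<phi>. inj_on \<phi> (pverts T) \<and> \<phi> ` pverts T \<subseteq> W \<and> (\<forall>u v. (u, v) \<in> parcs T \<longrightarrow> (\<phi> u, \<phi> v) \<in> A)"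
    proof (rule tree_embedding[where d = d])
      show "parcs T \<subseteq> pverts T \<times> pverts T" by (auto dest: T.wellformed')
      show "\<exists>u\<in>U. \<exists>x\<in>pverts T - U. (u, x) \<in> parcs T" if "U \<subset> pverts T" "U \<noteq> {}" for U
        by (rule connected_exits[OF GT conn that])
      show "\<not> list_cycle (parcs T) xs" for xs
        using list_cycle_imp_cycle[of T xs] acyc T.pair_wf_digraph_axioms by blast
      show "card {w. (v, w) \<in> parcs T} \<le> d" if "v \<in> pverts T" for v
        using degree_le_max_degree[OF _ that] T(2) T.pair_finite_verts by (meson order_trans)
      show "finite W" using W(1) host(1) finite_subset by blast
    qed (use symT irrT neT host girth W T.pair_finite_verts in auto)
    then obtain \<phi> where \<phi>: "inj_on \<phi> (pverts T)" "\<phi> ` pverts T \<subseteq> W"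
      "\<And>u v. (u, v) \<in> parcs T \<Longrightarrow> (\<phi> u, \<phi> v) \<in> A"
      by blast
    have "\<exists>\<iota>. \<iota> ` {..<k} \<subseteq> {a. a div M = v \<and> \<chi> a = c v} \<and> inj_on \<iota> {..<k}" if "v \<in> V" for v
    proof (rule card_le_inj)
      show "finite {a. a div M = v \<and> \<chi> a = c v}"
        by (rule finite_subset[OF _ div_fiber(1)[OF M, of v]]) blast
    qed (use c(2)[OF that] in simp_all)
    then obtain \<iota> where \<iota>: "\<iota> v ` {..<k} \<subseteq> {a. a div M = v \<and> \<chi> a = c v}" "inj_on (\<iota> v) {..<k}"
      if "v \<in> V" for v
      by metis
    (* The clique of u goes to k vertices of the common colour inside the clique of its image. *)
    define \<psi> where "\<psi> = (\<lambda>(u, i). \<iota> (\<phi> u) i)"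
    have \<phi>V: "\<phi> u \<in> V" if "u \<in> pverts T" for u using that \<phi>(2) W(1) by blast
    have \<psi>: "\<psi> (u, i) div M = \<phi> u" "\<chi> (\<psi> (u, i)) = c (\<phi> u)" if "u \<in> pverts T" "i < k" for u i
      using \<iota>(1)[OF \<phi>V[OF that(1)]] that(2) unfolding \<psi>_def by auto
    have inj: "inj_on \<psi> (pverts T \<times> {..<k})"
    proof (rule inj_onI, clarify)
      fix u i v j
      assume uv: "u \<in> pverts T" "v \<in> pverts T" "i < k" "j < k" "\<psi> (u, i) = \<psi> (v, j)"
      then have "\<phi> u = \<phi> v" using \<psi>(1) by metis
      then have "u = v" using inj_onD[OF \<phi>(1)] uv by blast
      moreover have "i = j" using uv \<open>u = v\<close> inj_onD[OF \<iota>(2)[OF \<phi>V[OF uv(1)]], of i j]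
        unfolding \<psi>_def by simp
      ultimately show "u = v \<and> i = j" by blast
    qed
    show "monochromatic_copy (closed_blowup T k) ?H \<chi>"
    proof (rule monochromatic_copyI[where \<psi> = \<psi>])
      show "inj_on \<psi> (pverts (closed_blowup T k))" using inj by (simp add: closed_blowup_def)
      show "\<psi> ` pverts (closed_blowup T k) \<subseteq> pverts ?H"
        using \<psi>(1) \<phi>V by (auto simp: closed_blowup_def nat_blowup_def)
      show "\<chi> (\<psi> x) = \<chi> (\<psi> y)"
        if "x \<in> pverts (closed_blowup T k)" "y \<in> pverts (closed_blowup T k)" for x y
      proof -
        obtain u i v j where p: "x = (u, i)" "y = (v, j)" using prod.exhaust by metis
        have e: "u \<in> pverts T" "v \<in> pverts T" "i < k" "j < k"
          using that unfolding p mem_closed_blowup by blast+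
        have "c (\<phi> u) = c (\<phi> v)" using W(4) \<phi>(2) e(1,2) by blast
        then show ?thesis using \<psi>(2)[OF e(1,3)] \<psi>(2)[OF e(2,4)] unfolding p by simp
      qed
      show "(\<psi> x, \<psi> y) \<in> parcs ?H" if xy: "(x, y) \<in> parcs (closed_blowup T k)" for x y
      proof -
        obtain u i v j where p: "x = (u, i)" "y = (v, j)" using prod.exhaust by metis
        have e: "u \<in> pverts T" "v \<in> pverts T" "i < k" "j < k"
          "u = v \<and> i \<noteq> j \<or> (u, v) \<in> parcs T"
          using xy unfolding p mem_closed_blowup by blast+
        have "x \<noteq> y" using e(5) T.pair_no_loops[of "(u, v)"] unfolding p by auto
        then have ne: "\<psi> x \<noteq> \<psi> y"
          using inj_onD[OF inj, of x y] e(1-4) unfolding p by blast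
        have fib: "\<psi> x div M = \<phi> u" "\<psi> y div M = \<phi> v"
          using \<psi>(1)[OF e(1,3)] \<psi>(1)[OF e(2,4)] unfolding p by simp_all
        have "\<phi> u = \<phi> v \<or> (\<phi> u, \<phi> v) \<in> A" using e(5) \<phi>(3) by blast
        then show ?thesis
          using fib ne \<phi>V[OF e(1)] \<phi>V[OF e(2)] by (simp add: nat_blowup_def)
      qed
      show "pair_wf_digraph (closed_blowup T k)" by (rule closed_blowup_graph[OF GT])
      show "pair_wf_digraph ?H" by (rule H.pair_wf_digraph_axioms)
    qed
  qed
  moreover have "max_degree ?H \<le> (20 * (2 * s * d)\<^sup>2 + 1) * (s * k)"
    using nat_blowup_max_degree[OF M host(1,3) deg] unfolding M_def .
  ultimately show ?thesis using GH by blast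
qed

text \<open>
  Boundedness has to be uniform over all blowup factors, which is possible because the maximum degree
  of the blowup controls both the tree and the factor \<open>k\<close>: every vertex is adjacent to the \<open>k - 1\<close> others
  of its clique and to a copy of each neighbour in the tree.
\<close>

lemma max_degree_closed_blowup:
  assumes T: "undirected_tree T" and k: "1 \<le> k"
  shows "max_degree T \<le> max_degree (closed_blowup T k)" "k \<le> max_degree (closed_blowup T k) + 1"
proof -
  have GT: "pair_graph T" and conn: "connected (with_proj T)"
    using T unfolding undirected_tree_def by auto
  interpret T: pair_graph T by (rule GT)
  obtain r where r: "r \<in> pverts T"
    using conn by (auto simp: connected_def strongly_connected_def)
  let ?B = "closed_blowup T k"
  have fin: "finite (pverts ?B)" using T.pair_finite_verts by (simp add: closed_blowup_def)
  have deg: "card S \<le> max_degree ?B"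
    if "v \<in> pverts T" "S \<subseteq> {w. ((v, 0), w) \<in> parcs ?B}" for v S
  proof -
    have "{w. ((v, 0), w) \<in> parcs ?B} \<subseteq> pverts ?B" by (auto simp: closed_blowup_def)
    then have "finite {w. ((v, 0), w) \<in> parcs ?B}" using fin finite_subset by blast
    then have "card S \<le> card {w. ((v, 0), w) \<in> parcs ?B}" using that by (intro card_mono)
    also have "\<dots> \<le> max_degree ?B"
      by (rule degree_le_max_degree[OF fin]) (use that k in \<open>auto simp: closed_blowup_def\<close>)
    finally show ?thesis .
  qed
  show "max_degree T \<le> max_degree ?B"
  proof (rule max_degree_leI)
    fix v assume v: "v \<in> pverts T"
    have "card ((\<lambda>w. (w, 0::nat)) ` {w. (v, w) \<in> parcs T}) \<le> max_degree ?B"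
      by (rule deg[OF v]) (use k v in \<open>auto simp: closed_blowup_def dest: T.wellformed'\<close>)
    then show "card {w. (v, w) \<in> parcs T} \<le> max_degree ?B"
      by (simp add: card_image inj_on_def)
  qed (rule T.pair_finite_verts)
  have "card (Pair r ` {1..<k}) \<le> max_degree ?B"
    by (rule deg[OF r]) (use k r in \<open>auto simp: closed_blowup_def\<close>)
  then show "k \<le> max_degree ?B + 1" by (simp add: card_image inj_on_def)
qed

section \<open>The family of closed blowups of trees\<close>

theorem corollary16:
  shows "vertex_degree_ramsey_bounded (closed_tree_blowups :: ('a \<times> nat) pair_pre_digraph set) \<and>
    (\<forall>d s k :: nat. 1 \<le> d \<longrightarrow> 2 \<le> s \<longrightarrow> 1 \<le> k \<longrightarrow>
      (\<exists>D :: nat. \<forall>T :: 'a pair_pre_digraph. undirected_tree T \<and> max_degree T \<le> d \<longrightarrow>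
        (\<exists>H :: nat pair_pre_digraph. pair_graph H \<and> max_degree H \<le> D \<and>
           vertex_arrows H s (closed_blowup T k))))"
proof (intro conjI allI impI)
  let ?D = "\<lambda>d s k :: nat. (20 * (2 * s * d)\<^sup>2 + 1) * (s * k)"
  show "vertex_degree_ramsey_bounded (closed_tree_blowups :: ('a \<times> nat) pair_pre_digraph set)"
    unfolding vertex_degree_ramsey_bounded_def
  proof (intro exI allI impI ballI)
    fix s :: nat and G :: "('a \<times> nat) pair_pre_digraph"
    assume s: "1 \<le> s" and "G \<in> closed_tree_blowups"
    then obtain T k where G: "G = closed_blowup T k" and T: "undirected_tree T" and k: "1 \<le> k"
      unfolding closed_tree_blowups_def by blast
    let ?m = "max_degree G"
    have m: "max_degree T \<le> ?m + 1" "k \<le> ?m + 1"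
      using max_degree_closed_blowup[OF T k] unfolding G by auto
    obtain H :: "nat pair_pre_digraph" where H: "pair_graph H" "max_degree H \<le> ?D (?m + 1) s k"
      "vertex_arrows H s G"
      using tree_blowup_host[OF _ s k T m(1)] unfolding G by auto
    have "vertex_degree_ramsey G s \<le> enat (max_degree H)"
      unfolding vertex_degree_ramsey_def using H by (intro INF_lower) auto
    also have "max_degree H \<le> ?D (?m + 1) s (?m + 1)"
      using H(2) by (rule order_trans) (use m(2) in \<open>intro mult_left_mono, auto\<close>)
    finally show "vertex_degree_ramsey G s \<le> enat (?D (?m + 1) s (?m + 1))" by simp
  qed
  fix d s k :: nat assume "1 \<le> d" "2 \<le> s" "1 \<le> k"
  then show "\<exists>D. \<forall>T :: 'a pair_pre_digraph. undirected_tree T \<and> max_degree T \<le> d \<longrightarrow>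
        (\<exists>H :: nat pair_pre_digraph. pair_graph H \<and> max_degree H \<le> D \<and>
           vertex_arrows H s (closed_blowup T k))"
    using tree_blowup_host[of d s k] by (intro exI[of _ "?D d s k"]) auto
qed

end
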